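(* Fix $0<\lambda\le1$. For every $m\ge1$, with $d=2^m$ and $N_m=2^m-1+2m$, there exist local quantum channels (one applied by Alice to her $N_m$ qubits, one applied by Bob to his $N_m$ qubits, each with output $\mathbb C^d$) and a bipartite state $\zeta_{m,\lambda}$ on $\mathbb C^d\otimes\mathbb C^d$ such that the channels map $$\Psi_\lambda^{\otimes N_m}\ \longmapsto\ F_{m,\lambda}\Phi_d+(1-F_{m,\lambda})\zeta_{m,\lambda},$$ where $$F_{m,\lambda}=\frac{d+2(d-1)\lambda+(d-1)(d-2)\lambda^2}{d^2}\ \ge\ \lambda^2 .$$
   Context: $\Psi_\lambda=\frac12\left(|00\rangle\langle00|+|11\rangle\langle11|+\lambda|00\rangle\langle11|+\lambda|11\rangle\langle00|\right)$ is a two-qubit state shared between Alice (first qubit) and Bob (second qubit). $\Phi_d=|\Phi_d\rangle\langle\Phi_d|$ with $|\Phi_d\rangle=\frac1{\sqrt d}\sum_{i=0}^{d-1}|i,i\rangle$ is the maximally entangled state on $\mathbb C^d\otimes\mathbb C^d$ (equivalently $m$ EPR pairs when $d=2^m$). Local channels means a product channel $\Lambda_A\otimes\Lambda_B$ of completely positive trace-preserving maps, with no communication and no postselection. *)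

theory Defs
  imports "Jordan_Normal_Form.Matrix"
begin

text \<open>
  Matrices over C^a tensor C^b have dimension \<open>a * b\<close>; the product basis vector |i,k> has index
  \<open>i * b + k\<close>, so an index \<open>r\<close> is split into \<open>r div b\<close> (first factor) and \<open>r mod b\<close> (second factor).
\<close>

definition kron :: "complex mat \<Rightarrow> complex mat \<Rightarrow> complex mat" where
  "kron A B = mat (dim_row A * dim_row B) (dim_col A * dim_col B)
     (\<lambda>(r, s). A $$ (r div dim_row B, s div dim_col B) * B $$ (r mod dim_row B, s mod dim_col B))"

definition kron_vec :: "complex vec \<Rightarrow> complex vec \<Rightarrow> complex vec" where
  "kron_vec u v = vec (dim_vec u * dim_vec v) (\<lambda>r. u $ (r div dim_vec v) * v $ (r mod dim_vec v))"

text \<open>The operator |u><v|.\<close>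

definition ket_bra :: "complex vec \<Rightarrow> complex vec \<Rightarrow> complex mat" where
  "ket_bra u v = mat (dim_vec u) (dim_vec v) (\<lambda>(i, j). u $ i * conjugate (v $ j))"

definition mat_trace :: "complex mat \<Rightarrow> complex" where
  "mat_trace A = (\<Sum>i<dim_row A. A $$ (i, i))"

text \<open>
  The order on \<^typ>\<open>complex\<close> is the one of \<open>HOL-Library.Complex_Order\<close>: \<open>0 \<le> z\<close> says that \<open>z\<close> is
  real and nonnegative. The quadratic form below is <v|A|v>.
\<close>

definition psd :: "nat \<Rightarrow> complex mat \<Rightarrow> bool" where
  "psd n A \<longleftrightarrow> A \<in> carrier_mat n n \<and> (\<forall>v \<in> carrier_vec n. 0 \<le> (A *\<^sub>v v) \<bullet>c v)"

definition density :: "nat \<Rightarrow> complex mat \<Rightarrow> bool" where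
  "density n A \<longleftrightarrow> psd n A \<and> mat_trace A = 1"


definition linear_map :: "nat \<Rightarrow> nat \<Rightarrow> (complex mat \<Rightarrow> complex mat) \<Rightarrow> bool" where
  "linear_map n p f \<longleftrightarrow>
     (\<forall>X \<in> carrier_mat n n. f X \<in> carrier_mat p p) \<and>
     (\<forall>X \<in> carrier_mat n n. \<forall>Y \<in> carrier_mat n n. f (X + Y) = f X + f Y) \<and>
     (\<forall>X \<in> carrier_mat n n. \<forall>c. f (c \<cdot>\<^sub>m X) = c \<cdot>\<^sub>m f X)"

text \<open>
  For linear \<open>f\<close> (from operators on C^a to operators on C^p) and \<open>g\<close> (from operators on C^b to
  operators on C^q), \<open>tensor_map a p b q f g\<close> is the tensor product map: it expands \<open>X\<close> in the
  basis |i><j| tensor |k><l| and replaces each basis element by \<open>f\<close> |i><j| tensor \<open>g\<close> |k><l|.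
  Lemma \<open>tensor_map_kron\<close> is its characterizing property.
\<close>

definition tensor_map ::
  "nat \<Rightarrow> nat \<Rightarrow> nat \<Rightarrow> nat \<Rightarrow> (complex mat \<Rightarrow> complex mat) \<Rightarrow> (complex mat \<Rightarrow> complex mat)
     \<Rightarrow> complex mat \<Rightarrow> complex mat" where
  "tensor_map a p b q f g X = mat (p * q) (p * q) (\<lambda>(r, s).
     \<Sum>i<a. \<Sum>j<a. \<Sum>k<b. \<Sum>l<b. X $$ (i * b + k, j * b + l) *
       kron (f (ket_bra (unit_vec a i) (unit_vec a j)))
            (g (ket_bra (unit_vec b k) (unit_vec b l))) $$ (r, s))"

text \<open>The ancilla C^k on which the identity acts is the first tensor factor.\<close>

definition completely_positive :: "nat \<Rightarrow> nat \<Rightarrow> (complex mat \<Rightarrow> complex mat) \<Rightarrow> bool" where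
  "completely_positive n p f \<longleftrightarrow>
     (\<forall>k X. psd (k * n) X \<longrightarrow> psd (k * p) (tensor_map k k n p (\<lambda>Y. Y) f X))"

definition quantum_channel :: "nat \<Rightarrow> nat \<Rightarrow> (complex mat \<Rightarrow> complex mat) \<Rightarrow> bool" where
  "quantum_channel n p f \<longleftrightarrow>
     linear_map n p f \<and> completely_positive n p f \<and>
     (\<forall>X \<in> carrier_mat n n. mat_trace (f X) = mat_trace X)"


definition Psi :: "real \<Rightarrow> complex mat" where
  "Psi lam =
     (let k00 = kron_vec (unit_vec 2 0) (unit_vec 2 0);
          k11 = kron_vec (unit_vec 2 1) (unit_vec 2 1)
      in (1 / 2) \<cdot>\<^sub>m (ket_bra k00 k00 + ket_bra k11 k11
           + of_real lam \<cdot>\<^sub>m ket_bra k00 k11 + of_real lam \<cdot>\<^sub>m ket_bra k11 k00))"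

definition Phi_vec :: "nat \<Rightarrow> complex vec" where
  "Phi_vec d = of_real (1 / sqrt (real d)) \<cdot>\<^sub>v
     vec (d * d) (\<lambda>r. \<Sum>i<d. kron_vec (unit_vec d i) (unit_vec d i) $ r)"

definition Phi :: "nat \<Rightarrow> complex mat" where
  "Phi d = ket_bra (Phi_vec d) (Phi_vec d)"

fun kron_power :: "complex mat \<Rightarrow> nat \<Rightarrow> complex mat" where
  "kron_power A 0 = 1\<^sub>m 1"
| "kron_power A (Suc n) = kron (kron_power A n) A"

text \<open>
  \<open>kron_power \<rho> N\<close>, for a two-qubit \<open>\<rho>\<close>, lives on qubits ordered A1 B1 A2 B2 ... AN BN. The local
  channels act on (A1 ... AN) and (B1 ... BN), so the qubits are reordered to A1 ... AN B1 ... BN.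
  \<open>interleave N a b\<close> is the index of the basis vector |a1 b1 ... aN bN> where \<open>a\<close> and \<open>b\<close> have the
  binary digits a1 ... aN and b1 ... bN (most significant first).
\<close>

definition interleave :: "nat \<Rightarrow> nat \<Rightarrow> nat \<Rightarrow> nat" where
  "interleave N a b = (\<Sum>k<N. 4 ^ k * (2 * (a div 2 ^ k mod 2) + b div 2 ^ k mod 2))"

definition regroup :: "nat \<Rightarrow> complex mat \<Rightarrow> complex mat" where
  "regroup N M = mat (2 ^ N * 2 ^ N) (2 ^ N * 2 ^ N) (\<lambda>(r, s).
     M $$ (interleave N (r div 2 ^ N) (r mod 2 ^ N), interleave N (s div 2 ^ N) (s mod 2 ^ N)))"


lemma linear_mapD:
  assumes "linear_map n p f" "X \<in> carrier_mat n n"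
  shows "f X \<in> carrier_mat p p"
    and "Y \<in> carrier_mat n n \<Longrightarrow> f (X + Y) = f X + f Y"
    and "f (c \<cdot>\<^sub>m X) = c \<cdot>\<^sub>m f X"
  using assms unfolding linear_map_def by auto

lemma ket_bra_unit_carrier [simp]: "ket_bra (unit_vec n i) (unit_vec n j) \<in> carrier_mat n n"
  by (simp add: ket_bra_def)

lemma linear_map_sum_entries:
  assumes f: "linear_map n p f" and "finite S" "S \<subseteq> {..<n} \<times> {..<n}" "r < p" "s < p"
  shows "f (mat n n (\<lambda>ij. if ij \<in> S then X ij else 0)) $$ (r, s) =
         (\<Sum>(i, j)\<in>S. X (i, j) * f (ket_bra (unit_vec n i) (unit_vec n j)) $$ (r, s))"
  using assms(2,3)
proof (induction S rule: finite_induct)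
  case empty
  have "f (0 \<cdot>\<^sub>m 0\<^sub>m n n) = 0 \<cdot>\<^sub>m f (0\<^sub>m n n)"
    by (rule linear_mapD(3)[OF f]) auto
  moreover have "f (0\<^sub>m n n) \<in> carrier_mat p p"
    using linear_mapD(1)[OF f] by simp
  moreover have "mat n n (\<lambda>ij. if ij \<in> {} then X ij else 0) = 0 \<cdot>\<^sub>m 0\<^sub>m n n"
    by (rule eq_matI) auto
  ultimately show ?case using assms(4,5)
    by (metis (no_types, lifting) carrier_matD index_smult_mat(1) mult_zero_left sum.empty)
next
  case (insert x S)
  obtain i j where x: "x = (i, j)" by fastforce
  have ij: "i < n" "j < n" using insert.prems x by auto
  let ?E = "ket_bra (unit_vec n i) (unit_vec n j)"
  let ?M = "\<lambda>S. mat n n (\<lambda>ij. if ij \<in> S then X ij else 0)"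
  have eq: "?M (insert x S) = X x \<cdot>\<^sub>m ?E + ?M S"
    using insert.hyps ij unfolding x by (intro eq_matI) (auto simp: ket_bra_def unit_vec_def)
  have "f (?M (insert x S)) = X x \<cdot>\<^sub>m f ?E + f (?M S)"
    unfolding eq by (subst linear_mapD(2)[OF f]) (auto simp: linear_mapD(3)[OF f])
  moreover have "f ?E \<in> carrier_mat p p" "f (?M S) \<in> carrier_mat p p"
    using linear_mapD(1)[OF f] by auto
  ultimately show ?case using insert assms(4,5) by (simp add: x)
qed

lemma linear_map_entries:
  assumes f: "linear_map n p f" and X: "X \<in> carrier_mat n n" and rs: "r < p" "s < p"
  shows "f X $$ (r, s) =
         (\<Sum>i<n. \<Sum>j<n. X $$ (i, j) * f (ket_bra (unit_vec n i) (unit_vec n j)) $$ (r, s))"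
proof -
  have "mat n n (\<lambda>ij. if ij \<in> {..<n} \<times> {..<n} then X $$ ij else 0) = X"
    using X by (intro eq_matI) auto
  then show ?thesis
    using linear_map_sum_entries[OF f _ subset_refl rs, of "\<lambda>ij. X $$ ij"]
    by (simp add: sum.cartesian_product)
qed

lemma tensor_map_kron:
  assumes f: "linear_map a p f" and g: "linear_map b q g"
    and A: "A \<in> carrier_mat a a" and B: "B \<in> carrier_mat b b"
  shows "tensor_map a p b q f g (kron A B) = kron (f A) (g B)"
proof (rule eq_matI)
  have fc: "dim_row (f Y) = p" "dim_col (f Y) = p" if "Y \<in> carrier_mat a a" for Y
    using linear_mapD(1)[OF f that] by auto
  have gc: "dim_row (g Y) = q" "dim_col (g Y) = q" if "Y \<in> carrier_mat b b" for Y
    using linear_mapD(1)[OF g that] by auto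
  show "dim_row (tensor_map a p b q f g (kron A B)) = dim_row (kron (f A) (g B))"
    "dim_col (tensor_map a p b q f g (kron A B)) = dim_col (kron (f A) (g B))"
    using A B by (auto simp: tensor_map_def kron_def fc gc)
  fix r s assume "r < dim_row (kron (f A) (g B))" "s < dim_col (kron (f A) (g B))"
  then have rs: "r < p * q" "s < p * q" using A B by (auto simp: kron_def fc gc)
  then have q: "q > 0" using gr0I by fastforce
  have rs': "r div q < p" "s div q < p" "r mod q < q" "s mod q < q"
    using rs q by (auto simp: less_mult_imp_div_less)
  let ?E = "\<lambda>n i j. ket_bra (unit_vec n i) (unit_vec n j)"
  have idx: "i * b + k < a * b" if "i < a" "k < b" for i k
  proof -
    have "i * b + k < Suc i * b" using that by simp
    also have "\<dots> \<le> a * b" using that by (intro mult_le_mono1) auto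
    finally show ?thesis .
  qed
  have "tensor_map a p b q f g (kron A B) $$ (r, s) =
    (\<Sum>i<a. \<Sum>j<a. \<Sum>k<b. \<Sum>l<b. (A $$ (i, j) * f (?E a i j) $$ (r div q, s div q)) *
       (B $$ (k, l) * g (?E b k l) $$ (r mod q, s mod q)))"
    using rs A B idx unfolding tensor_map_def
    by (simp add: kron_def fc gc) (intro sum.cong refl, simp add: algebra_simps)
  also have "\<dots> = (\<Sum>i<a. \<Sum>j<a. A $$ (i, j) * f (?E a i j) $$ (r div q, s div q)) *
                 (\<Sum>k<b. \<Sum>l<b. B $$ (k, l) * g (?E b k l) $$ (r mod q, s mod q))"
    by (subst sum_distrib_right, intro sum.cong refl, subst sum_distrib_right, intro sum.cong refl)
      (simp only: sum_distrib_left)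
  also have "\<dots> = f A $$ (r div q, s div q) * g B $$ (r mod q, s mod q)"
    using linear_map_entries[OF f A rs'(1,2)] linear_map_entries[OF g B rs'(3,4)] by simp
  also have "\<dots> = kron (f A) (g B) $$ (r, s)"
    using rs A B by (simp add: kron_def fc gc)
  finally show "tensor_map a p b q f g (kron A B) $$ (r, s) = kron (f A) (g B) $$ (r, s)" .
qed

lemma kron_power_carrier: "A \<in> carrier_mat 4 4 \<Longrightarrow> kron_power A N \<in> carrier_mat (4 ^ N) (4 ^ N)"
  by (induction N) (auto simp: kron_def)

lemma interleave_Suc:
  "interleave (Suc N) a b = interleave N (a div 2) (b div 2) * 4 + (2 * (a mod 2) + b mod 2)"
  unfolding interleave_def sum.lessThan_Suc_shift
  by (simp add: sum_distrib_left sum_distrib_right div_mult2_eq algebra_simps)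

lemma interleave_less: "interleave N a b < 4 ^ N"
proof (induction N arbitrary: a b)
  case (Suc N)
  have "interleave N (a div 2) (b div 2) < 4 ^ N" by (rule Suc.IH)
  moreover have "a mod 2 < 2" "b mod 2 < 2" by auto
  ultimately show ?case unfolding interleave_Suc power_Suc by linarith
qed (simp add: interleave_def)

lemma kron_power_interleave:
  assumes A: "A \<in> carrier_mat 4 4"
  shows "kron_power A N $$ (interleave N a b, interleave N a' b') =
    (\<Prod>k<N. A $$ (2 * (a div 2 ^ k mod 2) + b div 2 ^ k mod 2,
                 2 * (a' div 2 ^ k mod 2) + b' div 2 ^ k mod 2))"
proof (induction N arbitrary: a b a' b')
  case 0
  show ?case by (simp add: interleave_def)
next
  case (Suc N)
  have lt: "2 * (x mod 2) + y mod 2 < (4::nat)" for x y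
    using mod_less_divisor[of 2 x] mod_less_divisor[of 2 y] by linarith
  have dm: "(z * 4 + (2 * (x mod 2) + y mod 2)) div 4 = z"
    "(z * 4 + (2 * (x mod 2) + y mod 2)) mod 4 = 2 * (x mod 2) + y mod 2" for x y z :: nat
    using lt[of x y] by (simp_all only: div_mult_self3 mod_mult_self3 div_less mod_less add_0_right)
  have "kron_power A (Suc N) $$ (interleave (Suc N) a b, interleave (Suc N) a' b') =
      kron_power A N $$ (interleave N (a div 2) (b div 2), interleave N (a' div 2) (b' div 2)) *
      A $$ (2 * (a mod 2) + b mod 2, 2 * (a' mod 2) + b' mod 2)"
    using A kron_power_carrier[OF A, of N] interleave_less[of "Suc N" a b] interleave_less[of "Suc N" a' b']
    by (simp add: kron_def interleave_Suc dm mod_less[OF lt])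
  then show ?case
    unfolding Suc.IH prod.lessThan_Suc_shift
    by (simp add: div_mult2_eq)
qed

end

(* Alice and Bob relabel each string a of n = d - 1 bits as (c, s), where s is its syndrome for the
   Hamming code and a = c + e_s with c a codeword (e_0 = 0). The code is perfect, so this is a
   bijection onto codewords times {0,...,d-1}. They trace out c and keep s.
   Since Psi_lambda^(tensor n) = 2^-n sum_{x,y} lambda^|x+y| |xx><yy|, the result is
   d^-1 sum_{s,t} lambda^|e_s+e_t| |ss><tt|, whose overlap with Phi_d is F.
   A shared random shift of s, read off from m further pairs, makes all row sums of the coefficient
   matrix equal to F. Then the uniform vector is an eigenvector, so subtracting F Phi_d
   leaves a positive operator; zeta is its normalization (and arbitrary for lambda = 1, F = 1). *)

theory Submission
  imports Defs
begin

unbundle bit_operations_syntax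

section \<open>Channels that relabel the basis and trace out a register\<close>

text \<open>Quantifying over all functions \<open>x\<close> removes the carrier condition, so
  shifted or pushed-forward vectors can be plugged in directly.\<close>

lemma psd_iff:
  "psd n A \<longleftrightarrow> A \<in> carrier_mat n n \<and>
     (\<forall>x. 0 \<le> (\<Sum>i<n. \<Sum>j<n. A $$ (i, j) * x j * cnj (x i)))"
proof -
  have form: "(A *\<^sub>v v) \<bullet>c v = (\<Sum>i<n. \<Sum>j<n. A $$ (i, j) * v $ j * cnj (v $ i))"
    if "A \<in> carrier_mat n n" "v \<in> carrier_vec n" for v
    using that by (auto simp: scalar_prod_def sum_distrib_right lessThan_atLeast0 intro!: sum.cong)
  show ?thesis
  proof
    assume A: "psd n A"
    have "0 \<le> (\<Sum>i<n. \<Sum>j<n. A $$ (i, j) * x j * cnj (x i))" for x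
    proof -
      have "0 \<le> (A *\<^sub>v vec n x) \<bullet>c vec n x" using A by (simp add: psd_def)
      then show ?thesis using A form[of "vec n x"] by (simp add: psd_def)
    qed
    then show "A \<in> carrier_mat n n \<and>
     (\<forall>x. 0 \<le> (\<Sum>i<n. \<Sum>j<n. A $$ (i, j) * x j * cnj (x i)))"
      using A by (simp add: psd_def)
  next
    assume "A \<in> carrier_mat n n \<and>
     (\<forall>x. 0 \<le> (\<Sum>i<n. \<Sum>j<n. A $$ (i, j) * x j * cnj (x i)))"
    then show "psd n A" by (auto simp: psd_def form)
  qed
qed

text \<open>
  When \<open>(g, s) \<mapsto> \<pi> g s\<close> is a bijection onto the basis labels, this relabels |\<open>\<pi> g s\<close>> as
  |\<open>g, s\<close>> and traces out \<open>g\<close>.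
\<close>

definition block_channel :: "'g set \<Rightarrow> ('g \<Rightarrow> nat \<Rightarrow> nat) \<Rightarrow> nat \<Rightarrow> complex mat \<Rightarrow> complex mat" where
  "block_channel G \<pi> p X = mat p p (\<lambda>(s, t). \<Sum>g\<in>G. X $$ (\<pi> g s, \<pi> g t))"

text \<open>On a matrix unit |i><j|, entry (s, t) of a block channel counts the \<open>x\<close>
  with \<open>i = \<pi> x s\<close> and \<open>j = \<pi> x t\<close>, so the four basis sums
  collapse. Agreement is asked only on carrier matrices, which lets the identity be one of the
  factors.\<close>

lemma tensor_map_block_channel:
  fixes f :: "complex mat \<Rightarrow> complex mat"
  assumes f: "\<And>X. X \<in> carrier_mat a a \<Longrightarrow> f X = block_channel G \<pi> p X"
    and g: "\<And>X. X \<in> carrier_mat b b \<Longrightarrow> g X = block_channel H \<rho> q X"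
    and \<pi>: "\<And>x s. x \<in> G \<Longrightarrow> s < p \<Longrightarrow> \<pi> x s < a"
    and \<rho>: "\<And>y s. y \<in> H \<Longrightarrow> s < q \<Longrightarrow> \<rho> y s < b"
    and rs: "r < p * q" "s < p * q"
  shows "tensor_map a p b q f g X $$ (r, s) =
    (\<Sum>x\<in>G. \<Sum>y\<in>H. X $$ (\<pi> x (r div q) * b + \<rho> y (r mod q), \<pi> x (s div q) * b + \<rho> y (s mod q)))"
proof -
  have q: "q > 0" using rs gr0I by fastforce
  have rs': "r div q < p" "s div q < p" "r mod q < q" "s mod q < q"
    using rs q by (auto simp: less_mult_imp_div_less)
  let ?E = "\<lambda>n i j. ket_bra (unit_vec n i) (unit_vec n j)"
  have fE: "f (?E a i j) $$ (r div q, s div q) =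
      (\<Sum>x\<in>G. if i = \<pi> x (r div q) \<and> j = \<pi> x (s div q) then 1 else 0)" if "i < a" "j < a" for i j
    using that rs' \<pi> by (auto simp: f block_channel_def ket_bra_def unit_vec_def intro!: sum.cong)
  have gE: "g (?E b k l) $$ (r mod q, s mod q) =
      (\<Sum>y\<in>H. if k = \<rho> y (r mod q) \<and> l = \<rho> y (s mod q) then 1 else 0)" if "k < b" "l < b" for k l
    using that rs' \<rho> by (auto simp: g block_channel_def ket_bra_def unit_vec_def intro!: sum.cong)
  have dims: "dim_row (f (?E a i j)) = p" "dim_col (f (?E a i j)) = p"
    "dim_row (g (?E b k l)) = q" "dim_col (g (?E b k l)) = q" for i j k l
    by (auto simp: f g block_channel_def)
  have "tensor_map a p b q f g X $$ (r, s) =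
    (\<Sum>i<a. \<Sum>j<a. \<Sum>k<b. \<Sum>l<b. X $$ (i * b + k, j * b + l) *
      ((\<Sum>x\<in>G. if i = \<pi> x (r div q) \<and> j = \<pi> x (s div q) then 1 else 0) *
       (\<Sum>y\<in>H. if k = \<rho> y (r mod q) \<and> l = \<rho> y (s mod q) then 1 else 0)))"
    using rs by (simp add: tensor_map_def kron_def dims fE gE)
  also have "\<dots> = (\<Sum>i<a. \<Sum>j<a. \<Sum>k<b. \<Sum>l<b. \<Sum>x\<in>G. \<Sum>y\<in>H.
      if i = \<pi> x (r div q) then if j = \<pi> x (s div q) then if k = \<rho> y (r mod q) then
      if l = \<rho> y (s mod q) then X $$ (i * b + k, j * b + l) else 0 else 0 else 0 else 0)"
    unfolding sum_product unfolding sum_distrib_left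
    by (intro sum.cong refl) auto
  also have "\<dots> = (\<Sum>x\<in>G. \<Sum>y\<in>H. \<Sum>i<a. \<Sum>j<a. \<Sum>k<b. \<Sum>l<b.
      if i = \<pi> x (r div q) then if j = \<pi> x (s div q) then if k = \<rho> y (r mod q) then
      if l = \<rho> y (s mod q) then X $$ (i * b + k, j * b + l) else 0 else 0 else 0 else 0)"
    by (simp only: sum.swap[of _ H]) (simp only: sum.swap[of _ G])
  also have "\<dots> = (\<Sum>x\<in>G. \<Sum>y\<in>H.
      X $$ (\<pi> x (r div q) * b + \<rho> y (r mod q), \<pi> x (s div q) * b + \<rho> y (s mod q)))"
  proof (intro sum.cong refl)
    fix x y assume "x \<in> G" "y \<in> H"
    then have lt: "\<pi> x (r div q) < a" "\<pi> x (s div q) < a" "\<rho> y (r mod q) < b" "\<rho> y (s mod q) < b"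
      using rs' \<pi> \<rho> by auto
    have pull: "(\<Sum>i\<in>A. if P then h i else 0) = (if P then sum h A else 0)"
      for A :: "nat set" and P and h :: "nat \<Rightarrow> complex" by simp
    show "(\<Sum>i<a. \<Sum>j<a. \<Sum>k<b. \<Sum>l<b.
      if i = \<pi> x (r div q) then if j = \<pi> x (s div q) then if k = \<rho> y (r mod q) then
      if l = \<rho> y (s mod q) then X $$ (i * b + k, j * b + l) else 0 else 0 else 0 else 0) =
      X $$ (\<pi> x (r div q) * b + \<rho> y (r mod q), \<pi> x (s div q) * b + \<rho> y (s mod q))"
      using lt by (simp add: pull)
  qed
  finally show ?thesis .
qed

text \<open>\<open>B\<close> is the sum over \<open>g\<close> of adjoint(V) X V, where V maps |r> to
  |\<open>\<tau> g r\<close>>, so its form at \<open>x\<close> is a sum of forms of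
  \<open>X\<close>.\<close>

lemma psd_block_sum:
  assumes X: "psd n X" and B: "B \<in> carrier_mat p p" and fin: "finite G"
    and \<tau>: "\<And>g r. g \<in> G \<Longrightarrow> r < p \<Longrightarrow> \<tau> g r < n"
    and entry: "\<And>r s. r < p \<Longrightarrow> s < p \<Longrightarrow> B $$ (r, s) = (\<Sum>g\<in>G. X $$ (\<tau> g r, \<tau> g s))"
  shows "psd p B"
  unfolding psd_iff
proof (intro conjI allI B)
  fix x :: "nat \<Rightarrow> complex"
  \<comment> \<open>This is V x; the sum also covers values hit by several \<open>r\<close>.\<close>
  define y where "y g a = (\<Sum>r<p. if a = \<tau> g r then x r else 0)" for g a
  have form: "(\<Sum>a<n. \<Sum>b<n. X $$ (a, b) * y g b * cnj (y g a)) =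
      (\<Sum>r<p. \<Sum>s<p. X $$ (\<tau> g r, \<tau> g s) * x s * cnj (x r))" if g: "g \<in> G" for g
  proof -
    have "(\<Sum>b<n. Y b * y g b) = (\<Sum>s<p. Y (\<tau> g s) * x s)" for Y
    proof -
      have "(\<Sum>b<n. Y b * y g b) = (\<Sum>b<n. \<Sum>s<p. if b = \<tau> g s then Y b * x s else 0)"
        unfolding y_def sum_distrib_left by (intro sum.cong refl) auto
      also have "\<dots> = (\<Sum>s<p. \<Sum>b<n. if b = \<tau> g s then Y b * x s else 0)" by (rule sum.swap)
      also have "\<dots> = (\<Sum>s<p. Y (\<tau> g s) * x s)" using \<tau>[OF g] by (intro sum.cong refl) simp
      finally show ?thesis .
    qed
    note inner = this
    have "(\<Sum>a<n. Y a * cnj (y g a)) = (\<Sum>r<p. Y (\<tau> g r) * cnj (x r))" for Y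
      using arg_cong[OF inner[of "\<lambda>a. cnj (Y a)"], of cnj] by simp
    note outer = this
    show ?thesis by (simp only: inner outer sum_distrib_right[symmetric])
  qed
  have "(\<Sum>r<p. \<Sum>s<p. B $$ (r, s) * x s * cnj (x r)) =
      (\<Sum>r<p. \<Sum>s<p. \<Sum>g\<in>G. X $$ (\<tau> g r, \<tau> g s) * x s * cnj (x r))"
    by (simp add: entry sum_distrib_right)
  also have "\<dots> = (\<Sum>g\<in>G. \<Sum>a<n. \<Sum>b<n. X $$ (a, b) * y g b * cnj (y g a))"
    by (simp add: form sum.swap[of _ G])
  also have "\<dots> \<ge> 0" by (rule sum_nonneg) (use X in \<open>simp add: psd_iff\<close>)
  finally show "0 \<le> (\<Sum>r<p. \<Sum>s<p. B $$ (r, s) * x s * cnj (x r))" .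
qed

lemma pair_index_less:
  fixes i k a b :: nat
  assumes "i < a" "k < b"
  shows "i * b + k < a * b"
proof -
  have "i * b + k < Suc i * b" using assms by simp
  also have "\<dots> \<le> a * b" using assms by (intro mult_le_mono1) auto
  finally show ?thesis .
qed

text \<open>Tensoring with the identity gives a map of the same block form, so
  \<open>psd_block_sum\<close> yields complete positivity. Bijectivity makes every diagonal entry of
  \<open>X\<close> occur exactly once in the output trace.\<close>

lemma quantum_channel_block_channel:
  assumes bij: "bij_betw (\<lambda>(g, s). \<pi> g s) (G \<times> {..<p}) {..<n}" and fin: "finite G"
  shows "quantum_channel n p (block_channel G \<pi> p)"
proof -
  have lt: "\<pi> g s < n" if "g \<in> G" "s < p" for g s
    using bij_betwE[OF bij] that by auto
  have "linear_map n p (block_channel G \<pi> p)"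
    by (auto simp: linear_map_def block_channel_def lt sum.distrib sum_distrib_left intro!: eq_matI)
  moreover have "completely_positive n p (block_channel G \<pi> p)"
    unfolding completely_positive_def
  proof (intro allI impI)
    fix k X assume X: "psd (k * n) X"
    show "psd (k * p) (tensor_map k k n p (\<lambda>Y. Y) (block_channel G \<pi> p) X)"
    proof (rule psd_block_sum[OF X _ fin, where \<tau> = "\<lambda>g r. r div p * n + \<pi> g (r mod p)"])
      show "tensor_map k k n p (\<lambda>Y. Y) (block_channel G \<pi> p) X \<in> carrier_mat (k * p) (k * p)"
        by (simp add: tensor_map_def)
    next
      fix g r assume g: "g \<in> G" and r: "r < k * p"
      then have "p > 0" using gr0I by fastforce
      with g r show "r div p * n + \<pi> g (r mod p) < k * n"
        by (intro pair_index_less lt) (auto simp: less_mult_imp_div_less)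
    next
      fix r s assume rs: "r < k * p" "s < k * p"
      \<comment> \<open>The identity is the block channel over a one-point set.\<close>
      have id: "Y = block_channel {()} (\<lambda>_ s. s) k Y" if "Y \<in> carrier_mat k k" for Y
        using that by (auto simp: block_channel_def)
      show "tensor_map k k n p (\<lambda>Y. Y) (block_channel G \<pi> p) X $$ (r, s) =
          (\<Sum>g\<in>G. X $$ (r div p * n + \<pi> g (r mod p), s div p * n + \<pi> g (s mod p)))"
        by (subst tensor_map_block_channel[where G = "{()}" and \<pi> = "\<lambda>_ s. s", OF id refl _ lt rs]) auto
    qed
  qed
  moreover have "mat_trace (block_channel G \<pi> p X) = mat_trace X" if X: "X \<in> carrier_mat n n" for X
  proof -
    have "mat_trace (block_channel G \<pi> p X) = (\<Sum>g\<in>G. \<Sum>s<p. X $$ (\<pi> g s, \<pi> g s))"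
      by (simp add: mat_trace_def block_channel_def sum.swap[of _ G])
    also have "\<dots> = (\<Sum>(g, s)\<in>G \<times> {..<p}. X $$ (\<pi> g s, \<pi> g s))"
      by (rule sum.cartesian_product)
    also have "\<dots> = (\<Sum>a<n. X $$ (a, a))"
      using sum.reindex_bij_betw[OF bij, of "\<lambda>a. X $$ (a, a)"] by (simp add: split_def)
    finally show ?thesis using X by (simp add: mat_trace_def)
  qed
  ultimately show ?thesis by (simp add: quantum_channel_def)
qed

section \<open>The Hamming code with a key\<close>

text \<open>\<open>flip u\<close> is the error pattern \<open>e_u\<close>: bit \<open>u - 1\<close> is set, and \<open>u = 0\<close> stands for no error.\<close>

definition flip :: "nat \<Rightarrow> nat" where
  "flip u = (if u = 0 then 0 else 2 ^ (u - 1))"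

lemma bit_flip: "bit (flip u) j \<longleftrightarrow> u = Suc j"
  by (auto simp: flip_def bit_exp_iff)

text \<open>The parity check matrix of the Hamming code: its column at bit \<open>j\<close> is the binary expansion of \<open>j + 1\<close>.\<close>

primrec syndrome :: "nat \<Rightarrow> nat \<Rightarrow> nat" where
  "syndrome 0 x = 0"
| "syndrome (Suc n) x = syndrome n x XOR (if bit x n then Suc n else 0)"

lemma syndrome_xor: "syndrome n (x XOR y) = syndrome n x XOR syndrome n y"
  by (induction n) (auto simp: bit_xor_iff xor.assoc xor.left_commute)

text \<open>The column at bit \<open>u - 1\<close> is \<open>u\<close> itself, so for
  \<open>u \<le> n\<close> the syndrome names the error; a larger \<open>u\<close> flips a bit
  outside the block.\<close>

lemma syndrome_flip: "syndrome n (flip u) = (if u \<le> n then u else 0)"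
  by (induction n) (auto simp: bit_flip)

lemma syndrome_eq_0: "(\<And>j. j < n \<Longrightarrow> \<not> bit x j) \<Longrightarrow> syndrome n x = 0"
  by (induction n) auto

lemma xor_less: "x XOR y < 2 ^ n" if "x < 2 ^ n" "y < 2 ^ n" for x y n :: nat
  using that by (simp flip: take_bit_nat_eq_self_iff)

lemma syndrome_less: "n < 2 ^ m \<Longrightarrow> syndrome n x < 2 ^ m"
  by (induction n) (auto intro: xor_less)

definition block_length :: "nat \<Rightarrow> nat" where
  "block_length m = 2 ^ m - 1 + 2 * m"

text \<open>The syndrome reads only the lowest \<open>2 ^ m - 1\<close> bits, so these are Hamming
  codewords followed by \<open>2 * m\<close> free bits, among them the key.\<close>

definition codewords :: "nat \<Rightarrow> nat set" where
  "codewords m = {g. g < 2 ^ block_length m \<and> syndrome (2 ^ m - 1) g = 0}"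

text \<open>
  Measured in the computational basis, these bits agree for Alice and Bob. The key has \<open>m\<close> bits; the
  top \<open>m\<close> bits of a word belong to neither the key nor the Hamming block, since shifts alone
  already make the uniform vector an eigenvector of the output.
\<close>

definition key :: "nat \<Rightarrow> nat \<Rightarrow> nat" where
  "key m g = take_bit m (drop_bit (2 ^ m - 1) g)"

text \<open>The string with codeword \<open>g\<close> and output label \<open>s\<close>. Its
  syndrome is \<open>s XOR key m g\<close>, so the label is the syndrome shifted by the key.\<close>

definition word :: "nat \<Rightarrow> nat \<Rightarrow> nat \<Rightarrow> nat" where
  "word m g s = g XOR flip (s XOR key m g)"

lemma key_less: "key m g < 2 ^ m"
  by (simp add: key_def)

lemma key_xor: "key m (x XOR y) = key m x XOR key m y"
  by (simp add: key_def drop_bit_xor)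

lemma flip_less: "u < 2 ^ m \<Longrightarrow> flip u < 2 ^ (2 ^ m - 1)"
  unfolding flip_def by auto

lemma flip_less': "u < 2 ^ m \<Longrightarrow> flip u < 2 ^ block_length m"
  by (rule less_le_trans[OF flip_less]) (auto simp: block_length_def)

text \<open>Errors stay below the key bits, so a word and its codeword carry the same key.\<close>

lemma key_flip: "u < 2 ^ m \<Longrightarrow> key m (flip u) = 0"
  using flip_less[of u m] by (simp add: key_def drop_bit_eq_div)

lemma finite_codewords: "finite (codewords m)"
  by (rule finite_subset[of _ "{..<2 ^ block_length m}"]) (auto simp: codewords_def)

lemma word_less:
  assumes "g \<in> codewords m" "s < 2 ^ m"
  shows "word m g s < 2 ^ block_length m"
  unfolding word_def using assms key_less
  by (intro xor_less flip_less') (auto simp: codewords_def)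

lemma bij_betw_word:
  "bij_betw (\<lambda>(g, s). word m g s) (codewords m \<times> {..<2 ^ m}) {..<2 ^ block_length m}"
proof -
  define n :: nat where "n = 2 ^ m - 1"
  have codewords: "codewords m = {g. g < 2 ^ block_length m \<and> syndrome n g = 0}"
    by (simp add: codewords_def n_def)
  have key: "key m (a XOR flip u) = key m a" if "u < 2 ^ m" for a u
    using that by (simp add: key_xor key_flip)
  have syn: "syndrome n (a XOR flip u) = syndrome n a XOR u" if "u < 2 ^ m" for a u
    using that by (simp add: syndrome_xor syndrome_flip n_def)
  have syn_less: "syndrome n a < 2 ^ m" for a by (rule syndrome_less) (simp add: n_def)
  show ?thesis
  \<comment> \<open>Perfect decoding: the syndrome of \<open>a\<close> identifies the error to
    remove, and adding the key turns the syndrome back into the label.\<close>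
  proof (rule bij_betw_byWitness[where
        f' = "\<lambda>a. (a XOR flip (syndrome n a), syndrome n a XOR key m a)"])
    show "\<forall>x\<in>codewords m \<times> {..<2 ^ m}. (\<lambda>a. (a XOR flip (syndrome n a), syndrome n a XOR key m a))
        ((\<lambda>(g, s). word m g s) x) = x"
      by (auto simp: codewords word_def syn key key_less xor_less xor.assoc)
    show "\<forall>a\<in>{..<2 ^ block_length m}. (\<lambda>(g, s). word m g s)
        (a XOR flip (syndrome n a), syndrome n a XOR key m a) = a"
      by (auto simp: word_def key syn_less xor.assoc)
    show "(\<lambda>(g, s). word m g s) ` (codewords m \<times> {..<2 ^ m}) \<subseteq> {..<2 ^ block_length m}"
      by (auto intro: word_less)
    show "(\<lambda>a. (a XOR flip (syndrome n a), syndrome n a XOR key m a)) ` {..<2 ^ block_length m}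
        \<subseteq> codewords m \<times> {..<2 ^ m}"
      using syn_less by (auto simp: codewords syn xor_less key_less flip_less')
  qed
qed

lemma card_codewords: "card (codewords m) * 2 ^ m = 2 ^ block_length m"
  using bij_betw_same_card[OF bij_betw_word[of m]] by (simp add: card_cartesian_product)

lemma bij_betw_xor: "z < 2 ^ m \<Longrightarrow> bij_betw (\<lambda>x. x XOR z) {..<2 ^ m} {..<2 ^ m :: nat}"
  by (rule bij_betw_byWitness[where f' = "\<lambda>x. x XOR z"]) (auto simp: xor.assoc xor_less)

text \<open>Adding \<open>z\<close> to the key bits permutes the codewords.\<close>

lemma sum_codewords_shift:
  assumes z: "z < 2 ^ m"
  shows "(\<Sum>g\<in>codewords m. f (z XOR key m g)) = (\<Sum>g\<in>codewords m. f (key m g))"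
proof -
  let ?n = "2 ^ m - 1 :: nat"
  \<comment> \<open>\<open>z\<close> is placed at the key position; the Hamming bits of the mask are
    0, so XOR with it preserves codewords.\<close>
  let ?z = "push_bit ?n z"
  have "key m ?z = z" using z by (simp add: key_def drop_bit_push_bit take_bit_nat_eq_self)
  moreover have "?z < 2 ^ block_length m"
  proof -
    have "?z < 2 ^ ?n * 2 ^ m" using z by (simp add: push_bit_eq_mult mult.commute)
    also have "\<dots> \<le> 2 ^ block_length m" unfolding power_add[symmetric]
      by (intro power_increasing) (auto simp: block_length_def)
    finally show ?thesis .
  qed
  moreover have "syndrome ?n ?z = 0" by (rule syndrome_eq_0) (simp add: bit_push_bit_iff)
  ultimately have "bij_betw (\<lambda>g. g XOR ?z) (codewords m) (codewords m)"
    "key m (g XOR ?z) = z XOR key m g" for g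
    by (auto intro!: bij_betw_byWitness[where f' = "\<lambda>g. g XOR ?z"]
        simp: xor.assoc codewords_def syndrome_xor xor_less key_xor)
      (simp add: xor.commute)
  then show ?thesis using sum.reindex_bij_betw[of "\<lambda>g. g XOR ?z" _ _ "\<lambda>g. f (key m g)"] by simp
qed

section \<open>States supported on the diagonal vectors\<close>

text \<open>The operator with coefficient \<open>T i j\<close> on |i,i><j,j|. The output,
  \<open>Phi d\<close> and \<zeta> all have this form, which reduces the argument to real d by d
  matrices.\<close>

definition diag_embed :: "nat \<Rightarrow> (nat \<Rightarrow> nat \<Rightarrow> real) \<Rightarrow> complex mat" where
  "diag_embed d T = mat (d * d) (d * d) (\<lambda>(r, s).
     if r div d = r mod d \<and> s div d = s mod d then of_real (T (r mod d) (s mod d)) else 0)"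

lemma sum_diagonal:
  fixes f :: "nat \<Rightarrow> complex"
  shows "(\<Sum>r<d * d. if r div d = r mod d then f r else 0) = (\<Sum>i<d. f (i * d + i))"
proof -
  have "(\<Sum>r<d * d. if r div d = r mod d then f r else 0) =
      (\<Sum>r\<in>{r. r < d * d \<and> r div d = r mod d}. f r)"
    by (simp add: sum.inter_filter[symmetric])
  also have "\<dots> = (\<Sum>i<d. f (i * d + i))"
  proof (rule sum.reindex_bij_witness[of _ "\<lambda>i. i * d + i" "\<lambda>r. r mod d"])
    fix r assume r: "r \<in> {r. r < d * d \<and> r div d = r mod d}"
    then have "d > 0" using gr0I by fastforce
    with r show "r mod d \<in> {..<d}" by simp
    show "r mod d * d + r mod d = r" using r div_mult_mod_eq[of r d] by simp
    then show "f (r mod d * d + r mod d) = f r" by simp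
  qed (auto intro: pair_index_less)
  finally show ?thesis .
qed

lemma density_diag_embed:
  assumes form: "\<And>x. 0 \<le> (\<Sum>i<d. \<Sum>j<d. of_real (T i j) * x j * cnj (x i))"
    and tr: "(\<Sum>i<d. T i i) = 1"
  shows "density (d * d) (diag_embed d T)"
  unfolding density_def psd_iff
proof (intro conjI allI)
  show "diag_embed d T \<in> carrier_mat (d * d) (d * d)" by (simp add: diag_embed_def)
  fix x :: "nat \<Rightarrow> complex"
  have "(\<Sum>r<d * d. \<Sum>s<d * d. diag_embed d T $$ (r, s) * x s * cnj (x r)) =
      (\<Sum>r<d * d. if r div d = r mod d then (\<Sum>s<d * d. if s div d = s mod d then
        of_real (T (r mod d) (s mod d)) * x s * cnj (x r) else 0) else 0)"
    by (intro sum.cong refl) (auto simp: diag_embed_def intro!: sum.cong)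
  also have "\<dots> = (\<Sum>i<d. \<Sum>j<d. of_real (T i j) * x (j * d + j) * cnj (x (i * d + i)))"
    by (simp add: sum_diagonal)
  finally show "0 \<le> (\<Sum>r<d * d. \<Sum>s<d * d. diag_embed d T $$ (r, s) * x s * cnj (x r))"
    using form[of "\<lambda>j. x (j * d + j)"] by simp
next
  have "mat_trace (diag_embed d T) =
      (\<Sum>r<d * d. if r div d = r mod d then of_real (T (r mod d) (r mod d)) else 0)"
    unfolding mat_trace_def by (simp add: diag_embed_def)
  also have "\<dots> = of_real (\<Sum>i<d. T i i)" by (simp add: sum_diagonal)
  finally show "mat_trace (diag_embed d T) = 1" by (simp add: tr)
qed

lemma Phi_eq_diag_embed: "Phi d = diag_embed d (\<lambda>_ _. 1 / real d)"
proof (rule eq_matI)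
  have Phi_vec: "Phi_vec d $ r = (if r div d = r mod d then of_real (1 / sqrt (real d)) else 0)"
    if r: "r < d * d" for r
  proof -
    have "d > 0" using r gr0I by fastforce
    then have "r div d < d" "r mod d < d" using r by (auto simp: less_mult_imp_div_less)
    then have "(\<Sum>i<d. kron_vec (unit_vec d i) (unit_vec d i) $ r) =
        (\<Sum>i<d. if i = r div d then if r div d = r mod d then 1 else 0 else 0)"
      using r by (intro sum.cong refl) (auto simp: kron_vec_def unit_vec_def)
    also have "\<dots> = (if r div d = r mod d then 1 else 0)" using \<open>r div d < d\<close> by simp
    finally show ?thesis using r by (simp add: Phi_vec_def)
  qed
  have dim: "dim_vec (Phi_vec d) = d * d" by (simp add: Phi_vec_def)
  fix r s assume "r < dim_row (diag_embed d (\<lambda>_ _. 1 / real d))"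
    "s < dim_col (diag_embed d (\<lambda>_ _. 1 / real d))"
  then have rs: "r < d * d" "s < d * d" by (auto simp: diag_embed_def)
  have "complex_of_real (sqrt (real d)) * complex_of_real (sqrt (real d)) = of_nat d"
    by (simp flip: of_real_mult)
  then show "Phi d $$ (r, s) = diag_embed d (\<lambda>_ _. 1 / real d) $$ (r, s)"
    using rs by (simp add: Phi_def ket_bra_def dim Phi_vec diag_embed_def)
qed (auto simp: Phi_def ket_bra_def diag_embed_def Phi_vec_def)

lemma mult_cnj_nonneg: "0 \<le> z * cnj z" for z :: complex
  by (simp add: less_eq_complex_def)

lemma density_Phi: "d > 0 \<Longrightarrow> density (d * d) (Phi d)"
  unfolding Phi_eq_diag_embed
proof (rule density_diag_embed)
  fix x :: "nat \<Rightarrow> complex"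
  have "(\<Sum>i<d. \<Sum>j<d. of_real (1 / real d) * x j * cnj (x i)) =
      of_real (1 / real d) * ((\<Sum>j<d. x j) * cnj (\<Sum>i<d. x i))"
    unfolding cnj_sum sum_product unfolding sum_distrib_left
    by (subst sum.swap) (simp only: mult.assoc)
  also have "\<dots> \<ge> 0"
    by (rule mult_nonneg_nonneg[OF _ mult_cnj_nonneg]) (simp add: less_eq_complex_def)
  finally show "0 \<le> (\<Sum>i<d. \<Sum>j<d. of_real (1 / real d) * x j * cnj (x i))" .
qed simp

text \<open>
  Subtracting \<open>F \<cdot> Phi d\<close> keeps positivity because the uniform vector is an eigenvector of \<open>S\<close> with
  eigenvalue \<open>F\<close>: the form of the difference at \<open>x\<close> is that of \<open>S\<close> at \<open>x - mean x\<close>.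
\<close>

lemma diag_embed_split:
  assumes d: "d > 0" and F: "F < 1"
    and form: "\<And>x. 0 \<le> (\<Sum>i<d. \<Sum>j<d. of_real (S i j) * x j * cnj (x i))"
    and sym: "\<And>i j. S i j = S j i"
    and row: "\<And>i. i < d \<Longrightarrow> (\<Sum>j<d. S i j) = F"
    and tr: "(\<Sum>i<d. S i i) = 1"
  shows "\<exists>\<zeta>. density (d * d) \<zeta> \<and>
    diag_embed d S = complex_of_real F \<cdot>\<^sub>m Phi d + complex_of_real (1 - F) \<cdot>\<^sub>m \<zeta>"
proof (intro exI conjI)
  \<comment> \<open>The remainder of \<open>S\<close> after removing \<open>F\<close> times the
    matrix of \<open>Phi d\<close> has trace \<open>1 - F\<close>, hence this normalization.\<close>
  define T where "T i j = (S i j - F / d) / (1 - F)" for i j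
  show "diag_embed d S = complex_of_real F \<cdot>\<^sub>m Phi d + complex_of_real (1 - F) \<cdot>\<^sub>m diag_embed d T"
  proof (rule eq_matI)
    have "S i j = F * (1 / d) + (1 - F) * T i j" for i j
      using F by (simp add: T_def)
    then have "complex_of_real (S i j) = of_real F * of_real (1 / d) + of_real (1 - F) * of_real (T i j)" for i j
      by (metis of_real_add of_real_mult)
    note S = this
    fix r s assume "r < dim_row (complex_of_real F \<cdot>\<^sub>m Phi d + complex_of_real (1 - F) \<cdot>\<^sub>m diag_embed d T)"
      "s < dim_col (complex_of_real F \<cdot>\<^sub>m Phi d + complex_of_real (1 - F) \<cdot>\<^sub>m diag_embed d T)"
    then show "diag_embed d S $$ (r, s) =
      (complex_of_real F \<cdot>\<^sub>m Phi d + complex_of_real (1 - F) \<cdot>\<^sub>m diag_embed d T) $$ (r, s)"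
      unfolding Phi_eq_diag_embed by (simp add: diag_embed_def S)
  qed (auto simp: diag_embed_def)
  show "density (d * d) (diag_embed d T)"
  proof (rule density_diag_embed)
    fix x :: "nat \<Rightarrow> complex"
    define X where "X = (\<Sum>i<d. x i)"
    define \<mu> where "\<mu> = X / d"
    let ?Q = "\<Sum>i<d. \<Sum>j<d. of_real (S i j) * x j * cnj (x i)"
    have rowc: "(\<Sum>j<d. complex_of_real (S i j)) = of_real F" if "i < d" for i
      using row[OF that] by (metis of_real_sum)
    have colc: "(\<Sum>i<d. complex_of_real (S i j)) = of_real F" if "j < d" for j
      using rowc[OF that] by (simp add: sym)
    have "(\<Sum>i<d. \<Sum>j<d. of_real (S i j) * (x j - \<mu>) * cnj (x i - \<mu>)) =
      ?Q - (\<Sum>i<d. \<Sum>j<d. of_real (S i j) * (\<mu> * cnj (x i)))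
         - (\<Sum>i<d. \<Sum>j<d. of_real (S i j) * (x j * cnj \<mu>))
         + (\<Sum>i<d. \<Sum>j<d. of_real (S i j) * (\<mu> * cnj \<mu>))"
      by (simp add: algebra_simps sum.distrib sum_subtractf)
    also have "(\<Sum>i<d. \<Sum>j<d. of_real (S i j) * (\<mu> * cnj (x i))) = of_real F * \<mu> * cnj X"
      by (simp add: sum_distrib_right[symmetric] rowc)
        (simp add: sum_distrib_left[symmetric] X_def)
    also have "(\<Sum>i<d. \<Sum>j<d. of_real (S i j) * (x j * cnj \<mu>)) = of_real F * X * cnj \<mu>"
      by (subst sum.swap, simp add: sum_distrib_right[symmetric] colc)
        (simp add: sum_distrib_left[symmetric] sum_distrib_right[symmetric] X_def)
    also have "(\<Sum>i<d. \<Sum>j<d. of_real (S i j) * (\<mu> * cnj \<mu>)) = d * of_real F * \<mu> * cnj \<mu>"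
      by (simp add: sum_distrib_right[symmetric] rowc)
    \<comment> \<open>With \<open>\<mu> = X / d\<close> each of the three correction terms equals
      \<open>F / d * (X * cnj X)\<close> up to sign; two are subtracted and one is added.\<close>
    also have "?Q - of_real F * \<mu> * cnj X - of_real F * X * cnj \<mu> + d * of_real F * \<mu> * cnj \<mu> =
      ?Q - of_real (F / d) * (X * cnj X)"
      using d by (simp add: \<mu>_def field_simps)
    also have "X * cnj X = (\<Sum>i<d. \<Sum>j<d. x j * cnj (x i))"
      unfolding X_def cnj_sum sum_product by (rule sum.swap)
    also have "?Q - of_real (F / d) * (\<Sum>i<d. \<Sum>j<d. x j * cnj (x i)) =
        (\<Sum>i<d. \<Sum>j<d. of_real (S i j - F / d) * x j * cnj (x i))"
      by (simp add: sum_distrib_left algebra_simps sum_subtractf)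
    finally have "0 \<le> (\<Sum>i<d. \<Sum>j<d. of_real (S i j - F / d) * x j * cnj (x i))"
      using form[of "\<lambda>i. x i - \<mu>"] by simp
    then have "0 \<le> of_real (1 / (1 - F)) * (\<Sum>i<d. \<Sum>j<d. of_real (S i j - F / d) * x j * cnj (x i))"
      using F by (intro mult_nonneg_nonneg) (auto simp: less_eq_complex_def)
    also have "\<dots> = (\<Sum>i<d. \<Sum>j<d. of_real (T i j) * x j * cnj (x i))"
      unfolding sum_distrib_left T_def
      by (intro sum.cong refl) (simp add: field_simps)
    finally show "0 \<le> (\<Sum>i<d. \<Sum>j<d. of_real (T i j) * x j * cnj (x i))" .
  next
    show "(\<Sum>i<d. T i i) = 1"
      using F d by (simp add: T_def sum_divide_distrib[symmetric] sum_subtractf tr)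
  qed
qed

section \<open>The output state\<close>

text \<open>\<open>lam\<close> to the power of the Hamming distance between \<open>flip u\<close>
  and \<open>flip v\<close>, which is 0, 1 or 2.\<close>

definition coherence :: "real \<Rightarrow> nat \<Rightarrow> nat \<Rightarrow> real" where
  "coherence lam u v = (if u = v then 1 else if u = 0 \<or> v = 0 then lam else lam\<^sup>2)"

lemma coherence_sym: "coherence lam u v = coherence lam v u"
  by (auto simp: coherence_def)

text \<open>With a = (1, lam, ..., lam) the matrix is a a^T plus the diagonal of 1 - a_u^2.
  Positivity and the sum of all entries are both read off from this.\<close>

lemma coherence_rank_one:
  "coherence lam u v = (if u = 0 then 1 else lam) * (if v = 0 then 1 else lam) +
     (if u = v then 1 - (if u = 0 then 1 else lam)\<^sup>2 else 0)"
  by (simp add: coherence_def power2_eq_square)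

text \<open>\<open>u = Suc k\<close> is bit \<open>k\<close> of \<open>flip u\<close>, so
  \<open>lam\<close> appears once per differing bit; the bounds keep the flipped bits inside the
  product.\<close>

lemma prod_coherence:
  assumes "u \<le> N" "v \<le> N"
  shows "(\<Prod>k<N. if (u = Suc k) = (v = Suc k) then 1 else lam) = coherence lam u v"
proof (cases "u = v \<or> u = 0 \<or> v = 0")
  case True
  have single: "(\<Prod>k<N. if j \<noteq> k then 1 else lam) = lam" if "j < N" for j
  proof -
    have "(\<Prod>k<N. if j \<noteq> k then 1 else lam) = (\<Prod>k<N. if k = j then lam else 1)"
      by (intro prod.cong refl) auto
    then show ?thesis using that by (simp add: prod.delta)
  qed
  from True show ?thesis using assms
    by (cases u; cases v) (auto simp: coherence_def single)
next
  case False
  then obtain i j where ij: "u = Suc i" "v = Suc j" "i \<noteq> j" by (metis not0_implies_Suc)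
  have "(\<Prod>k<N. if (u = Suc k) = (v = Suc k) then 1 else lam) =
      (\<Prod>k<N. (if k = i then lam else 1) * (if k = j then lam else 1))"
    using ij by (intro prod.cong refl) auto
  then show ?thesis using ij assms
    by (simp add: prod.distrib prod.delta coherence_def power2_eq_square)
qed

lemma coherence_psd:
  assumes "0 \<le> lam" "lam \<le> 1"
  shows "0 \<le> (\<Sum>i<d. \<Sum>j<d. of_real (coherence lam i j) * x j * cnj (x i))"
proof -
  define a :: "nat \<Rightarrow> real" where "a u = (if u = 0 then 1 else lam)" for u
  have a: "0 \<le> 1 - (a u)\<^sup>2" for u
    using assms by (simp add: a_def power_le_one)
  have "(\<Sum>i<d. \<Sum>j<d. of_real (coherence lam i j) * x j * cnj (x i)) =
      (\<Sum>i<d. \<Sum>j<d. (of_real (a i) * cnj (x i)) * (of_real (a j) * x j)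
        + (if i = j then of_real (1 - (a i)\<^sup>2) * (x i * cnj (x i)) else 0))"
    unfolding coherence_rank_one a_def[symmetric]
    by (intro sum.cong refl) (simp add: algebra_simps)
  also have "\<dots> = cnj (\<Sum>i<d. of_real (a i) * x i) * (\<Sum>i<d. of_real (a i) * x i) +
      (\<Sum>i<d. of_real (1 - (a i)\<^sup>2) * (x i * cnj (x i)))"
    by (simp add: sum.distrib sum_product)
  also have "\<dots> \<ge> 0"
  proof (rule add_nonneg_nonneg)
    show "0 \<le> cnj (\<Sum>i<d. of_real (a i) * x i) * (\<Sum>i<d. of_real (a i) * x i)"
      by (subst mult.commute) (rule mult_cnj_nonneg)
    have "0 \<le> complex_of_real (1 - (a i)\<^sup>2)" for i
      using a[of i] by (simp add: less_eq_complex_def)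
    then show "0 \<le> (\<Sum>i<d. of_real (1 - (a i)\<^sup>2) * (x i * cnj (x i)))"
      by (intro sum_nonneg mult_nonneg_nonneg mult_cnj_nonneg)
  qed
  finally show ?thesis .
qed

text \<open>Summing the decomposition in \<open>coherence_rank_one\<close> gives, with n = d - 1, (1
  + n lam)^2 + n (1 - lam^2): the numerator of F.\<close>

lemma sum_coherence:
  assumes "d > 0"
  shows "(\<Sum>i<d. \<Sum>j<d. coherence lam i j) =
    real d + 2 * (real d - 1) * lam + (real d - 1) * (real d - 2) * lam\<^sup>2"
proof -
  define a :: "nat \<Rightarrow> real" where "a u = (if u = 0 then 1 else lam)" for u
  obtain n where n: "d = Suc n" using assms gr0_implies_Suc by blast
  have a: "(\<Sum>i<d. a i) = 1 + n * lam" "(\<Sum>i<d. (a i)\<^sup>2) = 1 + n * lam\<^sup>2"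
    unfolding n a_def sum.lessThan_Suc_shift by simp_all
  have "(\<Sum>i<d. \<Sum>j<d. coherence lam i j) =
      (\<Sum>i<d. a i) * (\<Sum>j<d. a j) + (\<Sum>i<d. 1 - (a i)\<^sup>2)"
    unfolding coherence_rank_one a_def[symmetric]
    by (simp add: sum.distrib sum_product)
  also have "\<dots> = real d + 2 * (real d - 1) * lam + (real d - 1) * (real d - 2) * lam\<^sup>2"
    unfolding sum_subtractf a by (simp add: n algebra_simps power2_eq_square)
  finally show ?thesis .
qed

text \<open>The output state is the sum of \<open>output_coeff lam m s t\<close> |\<open>s,s\<close>><\<open>t,t\<close>|.\<close>

definition output_coeff :: "real \<Rightarrow> nat \<Rightarrow> nat \<Rightarrow> nat \<Rightarrow> real" where
  "output_coeff lam m s t = (\<Sum>g\<in>codewords m. coherence lam (s XOR key m g) (t XOR key m g)) /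
     2 ^ block_length m"

lemma output_coeff_sym: "output_coeff lam m s t = output_coeff lam m t s"
  unfolding output_coeff_def by (subst coherence_sym) simp

lemma output_coeff_diag: "output_coeff lam m s s = 1 / 2 ^ m"
proof -
  have "real (card (codewords m)) * 2 ^ m = 2 ^ block_length m"
    by (metis card_codewords of_nat_mult of_nat_numeral of_nat_power)
  then show ?thesis by (simp add: output_coeff_def coherence_def field_simps)
qed

text \<open>For each \<open>g\<close>, XOR with the key permutes rows and columns simultaneously, so
  every summand inherits positivity from \<open>coherence\<close>.\<close>

lemma output_coeff_psd:
  assumes "0 \<le> lam" "lam \<le> 1"
  shows "0 \<le> (\<Sum>s<2 ^ m. \<Sum>t<2 ^ m. of_real (output_coeff lam m s t) * x t * cnj (x s))"
proof -
  let ?c = "\<lambda>g s t. complex_of_real (coherence lam (s XOR key m g) (t XOR key m g))"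
  have "0 \<le> (\<Sum>s<2 ^ m. \<Sum>t<2 ^ m. ?c g s t * x t * cnj (x s))" for g
  proof -
    let ?y = "\<lambda>u. x (u XOR key m g)"
    note re = sum.reindex_bij_betw[OF bij_betw_xor[OF key_less[of m g]], symmetric]
    have "(\<Sum>s<2 ^ m. \<Sum>t<2 ^ m. ?c g s t * x t * cnj (x s)) =
      (\<Sum>u<2 ^ m. \<Sum>v<2 ^ m. of_real (coherence lam u v) * ?y v * cnj (?y u))"
      by (subst re, subst (2) re) (simp add: xor.assoc)
    then show ?thesis using coherence_psd[OF assms] by simp
  qed
  then have "0 \<le> (\<Sum>g\<in>codewords m. \<Sum>s<2 ^ m. \<Sum>t<2 ^ m. ?c g s t * x t * cnj (x s))"
    by (rule sum_nonneg)
  then have "0 \<le> of_real (1 / 2 ^ block_length m) *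
      (\<Sum>g\<in>codewords m. \<Sum>s<2 ^ m. \<Sum>t<2 ^ m. ?c g s t * x t * cnj (x s))"
    by (rule mult_nonneg_nonneg[rotated]) (simp add: less_eq_complex_def)
  also have "\<dots> = (\<Sum>s<2 ^ m. \<Sum>t<2 ^ m. of_real (1 / 2 ^ block_length m) *
      (\<Sum>g\<in>codewords m. ?c g s t) * x t * cnj (x s))"
    by (simp only: sum.swap[of _ _ "codewords m"] sum_distrib_left sum_distrib_right mult.assoc)
  finally show ?thesis by (simp add: output_coeff_def)
qed

text \<open>A uniform key makes every row see the average of all row sums of
  \<open>coherence\<close>. This is the eigenvector condition of
  \<open>diag_embed_split\<close>.\<close>

lemma output_coeff_row:
  assumes s: "s < 2 ^ m"
  shows "(\<Sum>t<2 ^ m. output_coeff lam m s t) =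
    (\<Sum>u<2 ^ m. \<Sum>v<2 ^ m. coherence lam u v) / (2 ^ m)\<^sup>2"
proof -
  let ?\<rho> = "\<lambda>u. \<Sum>v<2 ^ m. coherence lam u v"
  have shift: "(\<Sum>t<2 ^ m. f (t XOR key m g)) = (\<Sum>t<2 ^ m. f t)" for f :: "nat \<Rightarrow> real" and g
    by (rule sum.reindex_bij_betw[OF bij_betw_xor[OF key_less]])
  have row: "(\<Sum>t<2 ^ m. output_coeff lam m s t) = (\<Sum>g\<in>codewords m. ?\<rho> (key m g)) / 2 ^ block_length m"
    if "s < 2 ^ m" for s
  proof -
    have "(\<Sum>t<2 ^ m. output_coeff lam m s t) =
        (\<Sum>g\<in>codewords m. \<Sum>t<2 ^ m. coherence lam (s XOR key m g) (t XOR key m g)) / 2 ^ block_length m"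
      unfolding output_coeff_def sum_divide_distrib[symmetric] by (subst sum.swap) simp
    then show ?thesis
      by (simp only: shift sum_codewords_shift[OF that, of ?\<rho>])
  qed
  \<comment> \<open>The sum over keys is invariant under shifts, so it equals its average over all
    \<open>z\<close>; after exchanging sums, each codeword meets every row once.\<close>
  have "2 ^ m * (\<Sum>g\<in>codewords m. ?\<rho> (key m g)) =
      (\<Sum>z<2 ^ m. \<Sum>g\<in>codewords m. ?\<rho> (z XOR key m g))"
    by (simp add: sum_codewords_shift[of _ m ?\<rho>])
  also have "\<dots> = (\<Sum>g\<in>codewords m. \<Sum>z<2 ^ m. ?\<rho> (z XOR key m g))" by (rule sum.swap)
  also have "\<dots> = real (card (codewords m)) * (\<Sum>u<2 ^ m. ?\<rho> u)"
    by (simp only: shift[of ?\<rho>] sum_constant)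
  finally have "2 ^ m * (\<Sum>g\<in>codewords m. ?\<rho> (key m g)) =
      real (card (codewords m)) * (\<Sum>u<2 ^ m. ?\<rho> u)" .
  moreover have "2 ^ block_length m = real (card (codewords m)) * 2 ^ m"
    by (metis card_codewords of_nat_mult of_nat_numeral of_nat_power)
  moreover from this have "real (card (codewords m)) \<noteq> 0" by (metis mult_eq_0_iff power_not_zero zero_neq_numeral)
  ultimately show ?thesis unfolding row[OF s]
    by (simp add: field_simps power2_eq_square)
qed

section \<open>Entries of the shared input state\<close>

lemma Psi_entry:
  assumes "x < 2" "y < 2" "x' < 2" "y' < 2"
  shows "Psi lam $$ (2 * x + y, 2 * x' + y') =
    (if x = y \<and> x' = y' then of_real (if x = x' then 1 else lam) / 2 else 0)"
proof -
  have "x = 0 \<or> x = 1" "y = 0 \<or> y = 1" "x' = 0 \<or> x' = 1" "y' = 0 \<or> y' = 1"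
    using assms by linarith+
  then show ?thesis
    by (elim disjE) (simp_all add: Psi_def Let_def ket_bra_def kron_vec_def unit_vec_def)
qed

lemma bit_ext_less:
  fixes a b :: nat
  assumes "a < 2 ^ N" "b < 2 ^ N" "\<And>k. k < N \<Longrightarrow> bit a k = bit b k"
  shows "a = b"
  using assms by (metis bit_take_bit_iff bit_eqI take_bit_nat_eq_self)

text \<open>Each pair is supported on equal bits, so Alice and Bob hold the same string; every bit
  where \<open>a\<close> and \<open>a'\<close> differ contributes a factor
  \<open>lam\<close>.\<close>

lemma regroup_entry:
  assumes lt: "a < 2 ^ N" "b < 2 ^ N" "a' < 2 ^ N" "b' < 2 ^ N"
  shows "regroup N (kron_power (Psi lam) N) $$ (a * 2 ^ N + b, a' * 2 ^ N + b') =
    (if a = b \<and> a' = b' then of_real ((\<Prod>k<N. if bit a k = bit a' k then 1 else lam) / 2 ^ N) else 0)"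
proof -
  have Psi: "Psi lam \<in> carrier_mat 4 4"
    by (auto simp: Psi_def Let_def ket_bra_def kron_vec_def)
  have digit: "c div 2 ^ k mod 2 = of_bool (bit c k)" for c k :: nat
    by (simp add: bit_iff_odd mod_2_eq_odd)
  have "regroup N (kron_power (Psi lam) N) $$ (a * 2 ^ N + b, a' * 2 ^ N + b') =
      kron_power (Psi lam) N $$ (interleave N a b, interleave N a' b')"
    using lt by (simp add: regroup_def pair_index_less)
  also have "\<dots> = (\<Prod>k<N. if bit a k = bit b k \<and> bit a' k = bit b' k
      then of_real (if bit a k = bit a' k then 1 else lam) / 2 else 0)"
    unfolding kron_power_interleave[OF Psi] digit
    by (intro prod.cong refl, subst Psi_entry) auto
  also have "\<dots> = (if a = b \<and> a' = b'
      then of_real ((\<Prod>k<N. if bit a k = bit a' k then 1 else lam) / 2 ^ N) else 0)"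
  proof (cases "a = b \<and> a' = b'")
    case True
    then show ?thesis by (simp add: prod_dividef)
  next
    case False
    then obtain k where "k < N" "\<not> (bit a k = bit b k \<and> bit a' k = bit b' k)"
      using bit_ext_less lt by metis
    then show ?thesis using False by (subst prod_zero) auto
  qed
  finally show ?thesis .
qed

lemma word_eq_iff:
  assumes "g \<in> codewords m" "h \<in> codewords m" "s < 2 ^ m" "t < 2 ^ m"
  shows "word m g s = word m h t \<longleftrightarrow> g = h \<and> s = t"
  using inj_onD[OF bij_betw_imp_inj_on[OF bij_betw_word], of m "(g, s)" "(h, t)"] assms by auto

text \<open>Equal strings have equal codewords, so only \<open>g = h\<close> survives in the double
  sum over the traced-out codewords.\<close>

lemma channel_output:
  fixes m :: nat and lam :: real
  defines "d \<equiv> 2 ^ m" and "N \<equiv> block_length m"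
  defines "\<Lambda> \<equiv> block_channel (codewords m) (word m) d"
  shows "tensor_map (2 ^ N) d (2 ^ N) d \<Lambda> \<Lambda> (regroup N (kron_power (Psi lam) N)) =
    diag_embed d (output_coeff lam m)"
proof (rule eq_matI)
  fix r s assume "r < dim_row (diag_embed d (output_coeff lam m))"
    "s < dim_col (diag_embed d (output_coeff lam m))"
  then have rs: "r < d * d" "s < d * d" by (auto simp: diag_embed_def)
  define r1 r2 s1 s2 where idx: "r1 = r div d" "r2 = r mod d" "s1 = s div d" "s2 = s mod d"
  have lt: "r1 < 2 ^ m" "r2 < 2 ^ m" "s1 < 2 ^ m" "s2 < 2 ^ m"
    using rs by (auto simp: idx less_mult_imp_div_less d_def)
  have wl: "word m g u < 2 ^ N" if "g \<in> codewords m" "u < 2 ^ m" for g u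
    using word_less that by (simp add: N_def)
  have weight: "(\<Prod>k<N. if bit (word m g s) k = bit (word m g t) k then 1 else lam) =
      coherence lam (s XOR key m g) (t XOR key m g)" if "s < 2 ^ m" "t < 2 ^ m" for g s t
  proof -
    have le: "u \<le> N" if "u < 2 ^ m" for u
      using that by (simp add: N_def block_length_def)
    \<comment> \<open>The codeword cancels between the two words, so they differ exactly where the
      error patterns do.\<close>
    have "(bit (word m g s) k = bit (word m g t) k) =
        ((s XOR key m g = Suc k) = (t XOR key m g = Suc k))" for k
      by (auto simp: word_def bit_xor_iff bit_flip)
    then show ?thesis using that key_less[of m g]
      by (simp add: prod_coherence le xor_less)
  qed
  have "tensor_map (2 ^ N) d (2 ^ N) d \<Lambda> \<Lambda> (regroup N (kron_power (Psi lam) N)) $$ (r, s) =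
    (\<Sum>g\<in>codewords m. \<Sum>h\<in>codewords m. regroup N (kron_power (Psi lam) N) $$
      (word m g r1 * 2 ^ N + word m h r2, word m g s1 * 2 ^ N + word m h s2))"
    unfolding idx by (rule tensor_map_block_channel[OF _ _ _ _ rs]) (auto simp: \<Lambda>_def d_def wl)
  also have "\<dots> = (\<Sum>g\<in>codewords m. \<Sum>h\<in>codewords m. if h = g then
      if r1 = r2 \<and> s1 = s2 then of_real (coherence lam (r1 XOR key m g) (s1 XOR key m g) / 2 ^ N) else 0 else 0)"
    using lt by (intro sum.cong refl) (auto simp: regroup_entry wl word_eq_iff weight)
  also have "\<dots> = (if r1 = r2 \<and> s1 = s2 then of_real (output_coeff lam m r2 s2) else 0)"
    by (auto simp: finite_codewords output_coeff_def sum_divide_distrib N_def)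
  also have "\<dots> = diag_embed d (output_coeff lam m) $$ (r, s)"
    using rs by (simp add: diag_embed_def idx)
  finally show "tensor_map (2 ^ N) d (2 ^ N) d \<Lambda> \<Lambda> (regroup N (kron_power (Psi lam) N)) $$ (r, s) =
    diag_embed d (output_coeff lam m) $$ (r, s)" .
qed (auto simp: tensor_map_def diag_embed_def)

section \<open>Bound on F and splitting of the output\<close>

theorem theorem5p3:
  fixes lam :: real and m :: nat
  assumes "0 < lam" and "lam \<le> 1" and "1 \<le> m"
  shows "let d = 2 ^ m :: nat;
             N = 2 ^ m - 1 + 2 * m :: nat;
             F = (real d + 2 * (real d - 1) * lam + (real d - 1) * (real d - 2) * lam\<^sup>2) / (real d)\<^sup>2
         in (\<exists>\<Lambda>\<^sub>A \<Lambda>\<^sub>B \<zeta>.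
               quantum_channel (2 ^ N) d \<Lambda>\<^sub>A \<and> quantum_channel (2 ^ N) d \<Lambda>\<^sub>B \<and> density (d * d) \<zeta> \<and>
               tensor_map (2 ^ N) d (2 ^ N) d \<Lambda>\<^sub>A \<Lambda>\<^sub>B (regroup N (kron_power (Psi lam) N)) =
                 complex_of_real F \<cdot>\<^sub>m Phi d + complex_of_real (1 - F) \<cdot>\<^sub>m \<zeta>) \<and>
            F \<ge> lam\<^sup>2"
proof -
  define d :: nat where "d = 2 ^ m"
  define N :: nat where "N = d - 1 + 2 * m"
  define F where "F = (real d + 2 * (real d - 1) * lam + (real d - 1) * (real d - 2) * lam\<^sup>2) / (real d)\<^sup>2"
  define \<Lambda> where "\<Lambda> = block_channel (codewords m) (word m) d"
  have N: "N = block_length m" by (simp add: N_def d_def block_length_def)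
  have d: "d \<ge> 2" using assms(3) self_le_power[of 2 m] by (simp add: d_def)
  have lam2: "lam\<^sup>2 \<le> lam" using assms by (simp add: power2_eq_square)
  have "(real d)\<^sup>2 * lam\<^sup>2 \<le> real d + 2 * (real d - 1) * lam + (real d - 1) * (real d - 2) * lam\<^sup>2"
  proof -
    \<comment> \<open>This is the right side of the claim minus the left; both terms are nonnegative
      because lam^2 \<le> lam \<le> 1.\<close>
    have "0 \<le> real d * (1 - lam\<^sup>2) + 2 * (real d - 1) * (lam - lam\<^sup>2)"
      using d lam2 assms(2) by (intro add_nonneg_nonneg mult_nonneg_nonneg) auto
    then show ?thesis by (simp add: algebra_simps power2_eq_square)
  qed
  then have F_ge: "lam\<^sup>2 \<le> F" using d by (simp add: F_def field_simps)
  have "quantum_channel (2 ^ N) d \<Lambda>"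
    unfolding \<Lambda>_def d_def N by (rule quantum_channel_block_channel[OF bij_betw_word finite_codewords])
  moreover have "tensor_map (2 ^ N) d (2 ^ N) d \<Lambda> \<Lambda> (regroup N (kron_power (Psi lam) N)) =
      diag_embed d (output_coeff lam m)"
    unfolding \<Lambda>_def d_def N by (rule channel_output)
  moreover have "\<exists>\<zeta>. density (d * d) \<zeta> \<and>
      diag_embed d (output_coeff lam m) = complex_of_real F \<cdot>\<^sub>m Phi d + complex_of_real (1 - F) \<cdot>\<^sub>m \<zeta>"
  proof (cases "lam = 1")
    case True
    \<comment> \<open>All coherences survive: the output is \<open>Phi d\<close> itself and
      \<open>F = 1\<close>, so \<zeta> has weight 0 and any state can stand in for it.\<close>
    have "coherence 1 u v = 1" for u v by (simp add: coherence_def)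
    then have "output_coeff lam m s t = output_coeff lam m s s" for s t
      by (simp add: True output_coeff_def)
    then have "diag_embed d (output_coeff lam m) = Phi d"
      by (simp add: Phi_eq_diag_embed diag_embed_def output_coeff_diag d_def cong: if_cong)
    moreover have "F = 1"
      using d by (simp add: F_def True field_simps power2_eq_square)
    moreover have "density (d * d) (Phi d)" using d by (intro density_Phi) simp
    ultimately show ?thesis by (intro exI[of _ "Phi d"]) (auto simp: Phi_eq_diag_embed diag_embed_def)
  next
    case False
    \<comment> \<open>This is d^2 minus the numerator of F; strictness comes from the first term, as
      \<open>d \<ge> 2\<close> and lam < 1.\<close>
    have "0 < 2 * (real d - 1) * (1 - lam) + (real d - 1) * (real d - 2) * (1 - lam\<^sup>2)"
      using d lam2 False assms(2) by (intro add_pos_nonneg mult_pos_pos mult_nonneg_nonneg) auto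
    then have "real d + 2 * (real d - 1) * lam + (real d - 1) * (real d - 2) * lam\<^sup>2 < (real d)\<^sup>2"
      by (simp add: algebra_simps power2_eq_square)
    then have "F < 1" using d by (simp add: F_def field_simps)
    then show ?thesis
    proof (rule diag_embed_split[rotated])
      show "d > 0" using d by simp
      show "0 \<le> (\<Sum>i<d. \<Sum>j<d. of_real (output_coeff lam m i j) * x j * cnj (x i))" for x
        unfolding d_def using assms by (intro output_coeff_psd) auto
      show "(\<Sum>j<d. output_coeff lam m i j) = F" if "i < d" for i
        using that d sum_coherence[of d lam] by (simp add: output_coeff_row F_def d_def)
      show "(\<Sum>i<d. output_coeff lam m i i) = 1" by (simp add: output_coeff_diag d_def)
    qed (rule output_coeff_sym)
  qed
  ultimately show ?thesis
    using F_ge unfolding Let_def d_def[symmetric] N_def[symmetric] F_def[symmetric] by metis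
qed

end
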